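(* Let $f:\mathbb{R}^n\to\mathbb{R}^n$ be a polynomial vector field that is asymptotically quasi-homogeneous at infinity of type $\alpha$ and order $k+1$, and let $T$ be an admissible quasi-homogeneous compactification of type $\alpha$ with functional $\kappa$. Let $y(t)$ be a solution of $y'=f(y)$ with interval of maximal existence time $(a,b)$, possibly $a=-\infty$ and $b=+\infty$. Assume that $y$ tends to infinity in the direction $x_*\in\mathcal{E}$ as $t\to b-0$ or $t\to a+0$. Then $x_*$ is an equilibrium, lying on $\mathcal{E}$, of the desingularized vector field $g$ on $\overline{\mathcal{D}}$.
   Context: Natural numbers are $\ge1$; $\alpha=(\alpha_1,\dots,\alpha_n)$ and $k$ consist of natural numbers, and $\beta_1,\dots,\beta_n,c$ are natural numbers with $\alpha_1\beta_1=\cdots=\alpha_n\beta_n=c$. Put $p(y)=\left(\sum_iy_i^{2\beta_i}\right)^{1/2c}$, $\mathcal{D}=\{p<1\}$, $\mathcal{E}=\partial\mathcal{D}=\{p=1\}$ (the horizon). Quasi-homogeneity: $h:\mathbb{R}^n\to\mathbb{R}$ is homogeneous of type $\alpha$ and order $m$ if $h(r^{\alpha_1}x_1,\dots,r^{\alpha_n}x_n)=r^mh(x)$ for all $x\in\mathbb{R}^n$, $r\in\mathbb{R}$. A vector field $(h_1,\dots,h_n)$ is quasi-homogeneous of type $\alpha$ and order $k+1$ if each $h_j$ is homogeneous of type $\alpha$ and order $k+\alpha_j$. A vector field $f$ is asymptotically quasi-homogeneous at infinity of type $\alpha$ and order $k+1$ if there is a quasi-homogeneous vector field $f_{\alpha,k}$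 of type $\alpha$ and order $k+1$ such that for each $j$, $\lim_{r\to+\infty}r^{-(k+\alpha_j)}\{f_j(r^{\alpha_1}x_1,\dots,r^{\alpha_n}x_n)-r^{k+\alpha_j}(f_{\alpha,k})_j(x)\}=0$ uniformly for $x\in S^{n-1}$. Admissibility: for a $C^1$ function $\kappa:\mathbb{R}^n\to\mathbb{R}$, the map $T(y)=x$, $x_i=y_i/\kappa(y)^{\alpha_i}$, is an admissible quasi-homogeneous compactification of type $\alpha$ if (A0) $\kappa(y)>p(y)$ for all $y$; (A1) $\kappa(y)\sim p(y)$ as $p(y)\to\infty$; (A2) $(\nabla\kappa(y))_i\sim\frac{1}{\alpha_i}\frac{y_i^{2\beta_i-1}}{p(y)^{2c-1}}$ as $p(y)\to\infty$ for each $i$; (A3) $\langle y_\alpha,\nabla\kappa(y)\rangle<\kappa(y)$ for all $y$, where $y_\alpha=(\alpha_1y_1,\dots,\alpha_ny_n)^T$. Here $a\sim b$ as $p(y)\to\infty$ means $a(y)=(1+\varepsilon(y))b(y)$ with $\varepsilon(y)\to0$ as $p(y)\to\infty$. Such a $T$ is a bijection of $\mathbb{R}^n$ onto $\mathcal{D}$. $y(t)$ tends to infinity in the direction $x_*\in\mathcal{E}$ as $t\to b-0$ (or $a+0$) if $p(y(t))\to\infty$ and $\left(\frac{y_1}{\kappa(y)^{\alpha_1}},\dots,\frac{y_n}{\kappa(y)^{\alpha_n}}\right)\to x_*$ as $t\to b-0$ (or $a+0$). Desingularized vector field: with new time $\tau$ given by $d\tau=\kappa(y(t))^kdt$ and $\tilde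 f_j(x)=\kappa^{-(k+\alpha_j)}f_j(\kappa^{\alpha_1}x_1,\dots,\kappa^{\alpha_n}x_n)$ (with $\kappa=\kappa(T^{-1}(x))$), the equation for $x=T(y)$ is $$\frac{dx_i}{d\tau}=g_i(x):=\tilde f_i(x)-\alpha_ix_i\sum_{j=1}^n(\nabla\kappa)_j\kappa^{\alpha_j-1}\tilde f_j(x),$$ and $g$ extends continuously from $\mathcal{D}$ to $\overline{\mathcal{D}}$; $g$ on $\mathcal{E}$ denotes this extension. *)

theory Defs
  imports "HOL-Analysis.Analysis" "HOL-Library.Landau_Symbols"
begin

definition qh_scale :: "('n::finite \<Rightarrow> nat) \<Rightarrow> real \<Rightarrow> real^'n \<Rightarrow> real^'n" where
  "qh_scale \<alpha> r x = (\<chi> i. r ^ \<alpha> i * x $ i)"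

definition homogeneous_of_type :: "('n::finite \<Rightarrow> nat) \<Rightarrow> nat \<Rightarrow> (real^'n \<Rightarrow> real) \<Rightarrow> bool" where
  "homogeneous_of_type \<alpha> m h \<longleftrightarrow> (\<forall>x r. h (qh_scale \<alpha> r x) = r ^ m * h x)"

text \<open>The next two predicates express order \<open>k + 1\<close>; their numeric argument is \<open>k\<close>.\<close>

definition quasi_homogeneous ::
  "('n::finite \<Rightarrow> nat) \<Rightarrow> nat \<Rightarrow> (real^'n \<Rightarrow> real^'n) \<Rightarrow> bool" where
  "quasi_homogeneous \<alpha> k h \<longleftrightarrow> (\<forall>j. homogeneous_of_type \<alpha> (k + \<alpha> j) (\<lambda>x. h x $ j))"

definition asymp_quasi_homogeneous ::
  "('n::finite \<Rightarrow> nat) \<Rightarrow> nat \<Rightarrow> (real^'n \<Rightarrow> real^'n) \<Rightarrow> bool" where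
  "asymp_quasi_homogeneous \<alpha> k f \<longleftrightarrow>
     (\<exists>h. quasi_homogeneous \<alpha> k h \<and>
       (\<forall>j. uniform_limit (sphere 0 1)
          (\<lambda>r x. (f (qh_scale \<alpha> r x) $ j - r ^ (k + \<alpha> j) * h x $ j) / r ^ (k + \<alpha> j))
          (\<lambda>x. 0) at_top))"

definition qh_p :: "('n::finite \<Rightarrow> nat) \<Rightarrow> nat \<Rightarrow> real^'n \<Rightarrow> real" where
  "qh_p \<beta> c y = root (2 * c) (\<Sum>i\<in>UNIV. (y $ i) ^ (2 * \<beta> i))"

definition qh_domain :: "('n::finite \<Rightarrow> nat) \<Rightarrow> nat \<Rightarrow> (real^'n) set" where
  "qh_domain \<beta> c = {x. qh_p \<beta> c x < 1}"

definition horizon :: "('n::finite \<Rightarrow> nat) \<Rightarrow> nat \<Rightarrow> (real^'n) set" where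
  "horizon \<beta> c = frontier (qh_domain \<beta> c)"

definition p_at_top :: "('n::finite \<Rightarrow> nat) \<Rightarrow> nat \<Rightarrow> (real^'n) filter" where
  "p_at_top \<beta> c = filtercomap (qh_p \<beta> c) at_top"

definition gradient :: "(real^'n::finite \<Rightarrow> real) \<Rightarrow> real^'n \<Rightarrow> real^'n" where
  "gradient \<kappa> y = (\<chi> i. frechet_derivative \<kappa> (at y) (axis i 1))"

definition C1_function :: "(real^'n::finite \<Rightarrow> real) \<Rightarrow> bool" where
  "C1_function \<kappa> \<longleftrightarrow> (\<forall>y. \<kappa> differentiable (at y)) \<and> continuous_on UNIV (gradient \<kappa>)"

definition qh_map :: "('n::finite \<Rightarrow> nat) \<Rightarrow> (real^'n \<Rightarrow> real) \<Rightarrow> real^'n \<Rightarrow> real^'n" where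
  "qh_map \<alpha> \<kappa> y = (\<chi> i. y $ i / \<kappa> y ^ \<alpha> i)"

text \<open>The relation \<open>a \<sim>[F] b\<close> of the library admits zeros of \<open>b\<close>, as needed for the
  condition on the gradient: see \<open>asymp_equiv_iff_relative_error\<close> below.\<close>

definition admissible_compactification ::
  "('n::finite \<Rightarrow> nat) \<Rightarrow> ('n \<Rightarrow> nat) \<Rightarrow> nat \<Rightarrow> (real^'n \<Rightarrow> real) \<Rightarrow> bool" where
  "admissible_compactification \<alpha> \<beta> c \<kappa> \<longleftrightarrow>
     C1_function \<kappa> \<and>
     (\<forall>y. \<kappa> y > qh_p \<beta> c y) \<and>
     \<kappa> \<sim>[p_at_top \<beta> c] qh_p \<beta> c \<and>
     (\<forall>i. (\<lambda>y. gradient \<kappa> y $ i) \<sim>[p_at_top \<beta> c]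
        (\<lambda>y. 1 / real (\<alpha> i) * ((y $ i) ^ (2 * \<beta> i - 1) / qh_p \<beta> c y ^ (2 * c - 1)))) \<and>
     (\<forall>y. (\<chi> i. real (\<alpha> i) * y $ i) \<bullet> gradient \<kappa> y < \<kappa> y)"

text \<open>An admissible \<open>qh_map \<alpha> \<kappa>\<close> is a bijection of the whole space onto the domain, so on the
  domain its inverse is given by \<open>inv\<close>.  Off the domain the value of \<open>desing_field\<close> is
  meaningless; there one has to use a continuous extension.\<close>

definition desing_field ::
  "('n::finite \<Rightarrow> nat) \<Rightarrow> nat \<Rightarrow> (real^'n \<Rightarrow> real) \<Rightarrow> (real^'n \<Rightarrow> real^'n) \<Rightarrow> real^'n \<Rightarrow> real^'n" where
  "desing_field \<alpha> k \<kappa> f x =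
     (let y = inv (qh_map \<alpha> \<kappa>) x;
          f' = (\<lambda>j. f (qh_scale \<alpha> (\<kappa> y) x) $ j / \<kappa> y ^ (k + \<alpha> j))
      in \<chi> i. f' i - real (\<alpha> i) * x $ i *
           (\<Sum>j\<in>UNIV. gradient \<kappa> y $ j * \<kappa> y ^ (\<alpha> j - 1) * f' j))"

definition desing_extension ::
  "('n::finite \<Rightarrow> nat) \<Rightarrow> ('n \<Rightarrow> nat) \<Rightarrow> nat \<Rightarrow> nat \<Rightarrow> (real^'n \<Rightarrow> real) \<Rightarrow> (real^'n \<Rightarrow> real^'n)
    \<Rightarrow> (real^'n \<Rightarrow> real^'n) \<Rightarrow> bool" where
  "desing_extension \<alpha> \<beta> c k \<kappa> f g \<longleftrightarrow>
     continuous_on (closure (qh_domain \<beta> c)) g \<and>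
     (\<forall>x\<in>qh_domain \<beta> c. g x = desing_field \<alpha> k \<kappa> f x)"

definition ode_solution_on ::
  "(real^'n::finite \<Rightarrow> real^'n) \<Rightarrow> ereal \<Rightarrow> ereal \<Rightarrow> (real \<Rightarrow> real^'n) \<Rightarrow> bool" where
  "ode_solution_on f a b y \<longleftrightarrow>
     a < b \<and> (\<forall>t\<in>einterval a b. (y has_vector_derivative f (y t)) (at t))"

definition maximal_solution_on ::
  "(real^'n::finite \<Rightarrow> real^'n) \<Rightarrow> ereal \<Rightarrow> ereal \<Rightarrow> (real \<Rightarrow> real^'n) \<Rightarrow> bool" where
  "maximal_solution_on f a b y \<longleftrightarrow>
     ode_solution_on f a b y \<and>
     (\<forall>a' b' z. a' \<le> a \<longrightarrow> b \<le> b' \<longrightarrow> ode_solution_on f a' b' z \<longrightarrow>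
        (\<forall>t\<in>einterval a b. z t = y t) \<longrightarrow> a' = a \<and> b' = b)"

definition to_right_end :: "ereal \<Rightarrow> real filter" where
  "to_right_end b = filtermap real_of_ereal (at_left b)"

definition to_left_end :: "ereal \<Rightarrow> real filter" where
  "to_left_end a = filtermap real_of_ereal (at_right a)"

definition tends_to_infinity_in_direction ::
  "('n::finite \<Rightarrow> nat) \<Rightarrow> ('n \<Rightarrow> nat) \<Rightarrow> nat \<Rightarrow> (real^'n \<Rightarrow> real) \<Rightarrow> (real \<Rightarrow> real^'n)
    \<Rightarrow> real^'n \<Rightarrow> real filter \<Rightarrow> bool" where
  "tends_to_infinity_in_direction \<alpha> \<beta> c \<kappa> y x F \<longleftrightarrow>
     x \<in> horizon \<beta> c \<and>
     filterlim (\<lambda>t. qh_p \<beta> c (y t)) at_top F \<and>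
     ((\<lambda>t. qh_map \<alpha> \<kappa> (y t)) \<longlongrightarrow> x) F"

lemma asymp_equiv_iff_relative_error:
  fixes a b :: "'a \<Rightarrow> real"
  shows "a \<sim>[F] b \<longleftrightarrow>
    (\<exists>\<epsilon>. (\<epsilon> \<longlongrightarrow> 0) F \<and> (\<forall>\<^sub>F y in F. a y = (1 + \<epsilon> y) * b y))"
proof
  assume ab: "a \<sim>[F] b"
  let ?q = "\<lambda>y. if a y = 0 \<and> b y = 0 then 1 else a y / b y"
  have "(?q \<longlongrightarrow> 1) F" using ab by (rule asymp_equivD)
  then have "((\<lambda>y. ?q y - 1) \<longlongrightarrow> 1 - 1) F" by (intro tendsto_intros)
  moreover have "\<forall>\<^sub>F y in F. a y = (1 + (?q y - 1)) * b y"
    using asymp_equiv_eventually_zeros[OF ab] by eventually_elim auto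
  ultimately show "\<exists>\<epsilon>. (\<epsilon> \<longlongrightarrow> 0) F \<and> (\<forall>\<^sub>F y in F. a y = (1 + \<epsilon> y) * b y)"
    by (intro exI[of _ "\<lambda>y. ?q y - 1"] conjI) simp_all
next
  assume "\<exists>\<epsilon>. (\<epsilon> \<longlongrightarrow> 0) F \<and> (\<forall>\<^sub>F y in F. a y = (1 + \<epsilon> y) * b y)"
  then obtain \<epsilon> where lim: "(\<epsilon> \<longlongrightarrow> 0) F" and ev: "\<forall>\<^sub>F y in F. a y = (1 + \<epsilon> y) * b y"
    by blast
  have "((\<lambda>y. if b y = 0 then 1 else 1 + \<epsilon> y) \<longlongrightarrow> 1) F"
  proof (rule tendstoI)
    fix e :: real assume "e > 0"
    show "\<forall>\<^sub>F y in F. dist (if b y = 0 then 1 else 1 + \<epsilon> y) 1 < e"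
      using tendstoD[OF lim \<open>e > 0\<close>] by eventually_elim (use \<open>e > 0\<close> in \<open>auto simp: dist_norm\<close>)
  qed
  moreover have "\<forall>\<^sub>F y in F. (if b y = 0 then 1 else 1 + \<epsilon> y) =
      (if a y = 0 \<and> b y = 0 then 1 else a y / b y)"
    using ev by eventually_elim auto
  ultimately show "a \<sim>[F] b"
    unfolding asymp_equiv_def by (rule Lim_transform_eventually)
qed

lemma GDERIV_gradient:
  assumes "\<kappa> differentiable (at y)"
  shows "GDERIV \<kappa> y :> gradient \<kappa> y"
proof -
  let ?D = "frechet_derivative \<kappa> (at y)"
  have D: "(\<kappa> has_derivative ?D) (at y)"
    using assms by (simp add: frechet_derivative_works)
  then interpret linear ?D by (rule has_derivative_linear)
  have "?D h = h \<bullet> gradient \<kappa> y" for h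
  proof -
    have "?D h = ?D (\<Sum>i\<in>UNIV. h $ i *\<^sub>R axis i 1)"
      using basis_expansion[of h] by (simp add: scalar_mult_eq_scaleR)
    then show ?thesis
      by (simp add: sum scale gradient_def inner_vec_def)
  qed
  then have "?D = (\<lambda>h. h \<bullet> gradient \<kappa> y)" by blast
  with D show ?thesis by (simp add: gderiv_def)
qed

lemma continuous_on_qh_p: "continuous_on S (qh_p \<beta> c)"
  unfolding qh_p_def by (intro continuous_intros)

lemma qh_p_scale:
  fixes \<alpha> \<beta> :: "'n::finite \<Rightarrow> nat"
  assumes "\<And>i. \<alpha> i * \<beta> i = c" "c \<ge> 1" "r \<ge> 0"
  shows "qh_p \<beta> c (qh_scale \<alpha> r x) = r * qh_p \<beta> c x"
proof -
  have "(r ^ \<alpha> i * x $ i) ^ (2 * \<beta> i) = r ^ (2 * c) * (x $ i) ^ (2 * \<beta> i)" for i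
  proof -
    have "\<alpha> i * (2 * \<beta> i) = 2 * c" using assms(1)[of i] by simp
    then have "(r ^ \<alpha> i) ^ (2 * \<beta> i) = r ^ (2 * c)" by (simp only: power_mult[symmetric])
    then show ?thesis by (simp only: power_mult_distrib)
  qed
  then have "qh_p \<beta> c (qh_scale \<alpha> r x) =
      root (2 * c) (r ^ (2 * c) * (\<Sum>i\<in>UNIV. (x $ i) ^ (2 * \<beta> i)))"
    by (simp add: qh_p_def qh_scale_def sum_distrib_left)
  also have "\<dots> = r * qh_p \<beta> c x"
    using assms(2,3) by (simp add: qh_p_def real_root_mult real_root_power_cancel)
  finally show ?thesis .
qed

lemma closure_qh_domain:
  fixes \<alpha> \<beta> :: "'n::finite \<Rightarrow> nat"
  assumes "\<And>i. \<alpha> i * \<beta> i = c" "c \<ge> 1"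
  shows "closure (qh_domain \<beta> c) = {x. qh_p \<beta> c x \<le> 1}"
proof
  have "closed {x. qh_p \<beta> c x \<le> 1}"
    by (intro closed_Collect_le continuous_on_qh_p continuous_intros)
  then show "closure (qh_domain \<beta> c) \<subseteq> {x. qh_p \<beta> c x \<le> 1}"
    by (intro closure_minimal) (auto simp: qh_domain_def)
  show "{x. qh_p \<beta> c x \<le> 1} \<subseteq> closure (qh_domain \<beta> c)"
  proof
    fix x :: "real^'n" assume x: "x \<in> {x. qh_p \<beta> c x \<le> 1}"
    let ?r = "\<lambda>n. 1 - inverse (real (Suc n))"
    have r: "?r n \<ge> 0" "?r n < 1" for n
      by (simp_all add: field_simps)
    have "?r n * qh_p \<beta> c x < 1" for n
    proof -
      have "?r n * qh_p \<beta> c x \<le> ?r n * 1"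
        using r(1) x by (intro mult_left_mono) auto
      also have "\<dots> < 1" using r(2)[of n] by simp
      finally show ?thesis .
    qed
    then have "qh_scale \<alpha> (?r n) x \<in> qh_domain \<beta> c" for n
      using qh_p_scale[of \<alpha> \<beta> c, OF assms r(1)] by (simp add: qh_domain_def)
    moreover have "(\<lambda>n. qh_scale \<alpha> (?r n) x) \<longlonglongrightarrow> x"
    proof -
      have "?r \<longlonglongrightarrow> 1 - 0" by (intro tendsto_intros LIMSEQ_inverse_real_of_nat)
      then have "(\<lambda>n. ?r n ^ \<alpha> i * x $ i) \<longlonglongrightarrow> (1 - 0) ^ \<alpha> i * x $ i" for i
        by (rule tendsto_mult[OF tendsto_power tendsto_const])
      then show ?thesis by (intro vec_tendstoI) (simp add: qh_scale_def)
    qed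
    ultimately show "x \<in> closure (qh_domain \<beta> c)"
      unfolding closure_sequential by (intro exI[of _ "\<lambda>n. qh_scale \<alpha> (?r n) x"]) blast
  qed
qed

lemma horizon_eq:
  fixes \<alpha> \<beta> :: "'n::finite \<Rightarrow> nat"
  assumes "\<And>i. \<alpha> i * \<beta> i = c" "c \<ge> 1"
  shows "horizon \<beta> c = {x. qh_p \<beta> c x = 1}"
proof -
  have "open (qh_domain \<beta> c)"
    unfolding qh_domain_def by (intro open_Collect_less continuous_on_qh_p continuous_intros)
  then show ?thesis
    using closure_qh_domain[of \<alpha> \<beta> c, OF assms]
    by (auto simp: horizon_def frontier_def interior_open qh_domain_def)
qed

lemma desing_extension_unique:
  assumes g: "desing_extension \<alpha> \<beta> c k \<kappa> f g" and h: "desing_extension \<alpha> \<beta> c k \<kappa> f h"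
    and x: "x \<in> closure (qh_domain \<beta> c)"
  shows "g x = h x"
proof -
  have "(\<lambda>x. g x - h x) x = 0"
  proof (rule continuous_constant_on_closure[OF _ _ x])
    show "continuous_on (closure (qh_domain \<beta> c)) (\<lambda>x. g x - h x)"
      using g h by (intro continuous_intros) (auto simp: desing_extension_def)
  qed (use g h in \<open>auto simp: desing_extension_def\<close>)
  then show ?thesis by simp
qed

lemma to_right_end_simps:
  "to_right_end (ereal s) = at_left s" "to_right_end \<infinity> = at_top"
  unfolding to_right_end_def by (simp_all add: at_left_ereal at_left_PInf filtermap_filtermap)

lemma to_left_end_simps:
  "to_left_end (ereal s) = at_right s" "to_left_end (-\<infinity>) = at_bot"
  unfolding to_left_end_def by (simp_all add: at_right_ereal at_right_MInf filtermap_filtermap)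

end

theory Submission
  imports Defs
begin

text \<open>
  By (A3), \<open>\<kappa>(r\<^sup>\<alpha>x) / r\<close> is strictly decreasing in \<open>r > 0\<close>, so \<open>T\<close> is injective; it is onto \<open>\<D>\<close> by
  (A1), and its inverse is continuous by invariance of domain.  Expanding the polynomial
  \<open>f\<^sub>j(r\<^sup>\<alpha>x)\<close> in powers of \<open>r\<close>, asymptotic quasi-homogeneity bounds its degree by \<open>k + \<alpha>\<^sub>j\<close>, so the
  rescaled field is a polynomial in \<open>1/\<kappa>\<close> and extends continuously to the horizon, where
  \<open>1/\<kappa>\<close> becomes \<open>0\<close>.

  For the equilibrium, write \<open>x = T(y(t))\<close> and \<open>S = \<Sum>\<^sub>j (\<nabla>\<kappa>)\<^sub>j \<kappa> ^ (\<alpha>\<^sub>j - 1) f'\<^sub>j\<close>, where \<open>f'\<close> is the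
  rescaled field.  Then \<open>(ln \<kappa>)' = \<kappa>\<^sup>k S\<close> and \<open>x\<^sub>i' = \<kappa>\<^sup>k g\<^sub>i\<close> along the solution.  If \<open>g\<^sub>i(x\<^sub>*) \<noteq> 0\<close>,
  then near the end of the time interval \<open>|(ln \<kappa>)'|\<close> is at most a constant times \<open>\<plusminus>x\<^sub>i'\<close>;
  as \<open>x\<^sub>i\<close> stays bounded, so does \<open>ln \<kappa>\<close>, contradicting \<open>\<kappa> \<ge> p \<rightarrow> \<infinity>\<close>.
\<close>

section \<open>Quasi-homogeneous scaling and polynomials\<close>

lemma qh_scale_nth [simp]: "qh_scale \<alpha> r x $ i = r ^ \<alpha> i * x $ i"
  by (simp add: qh_scale_def)

lemma qh_scale_mult: "qh_scale \<alpha> r (qh_scale \<alpha> s x) = qh_scale \<alpha> (r * s) x"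
  by (simp add: vec_eq_iff power_mult_distrib mult.assoc)

lemma qh_scale_one [simp]: "qh_scale \<alpha> 1 x = x"
  by (simp add: vec_eq_iff)

lemma continuous_on_qh_scale [continuous_intros]:
  "continuous_on S r \<Longrightarrow> continuous_on S x \<Longrightarrow> continuous_on S (\<lambda>t. qh_scale \<alpha> (r t) (x t))"
  unfolding qh_scale_def by (intro continuous_intros)

lemma has_vector_derivative_vec_lambda:
  fixes f :: "'n::finite \<Rightarrow> real \<Rightarrow> real"
  assumes "\<And>i. (f i has_vector_derivative f' i) (at t within S)"
  shows "((\<lambda>t. \<chi> i. f i t) has_vector_derivative (\<chi> i. f' i)) (at t within S)"
  using assms unfolding has_vector_derivative_def
  by (subst has_derivative_componentwise_within) (auto simp: Basis_vec_def inner_axis)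

text \<open>The norm along the scaling orbit of \<open>x\<close> runs from 0 at \<open>r = 0\<close>
  to at least 1 at \<open>r = R\<close>. The asymptotic hypothesis speaks only about the unit
  sphere, so nonzero points have to be moved there.\<close>

lemma exists_qh_scale_on_sphere:
  fixes x :: "real^'n::finite"
  assumes "\<And>i. \<alpha> i \<ge> 1" and "x \<noteq> 0"
  obtains r where "r > 0" and "qh_scale \<alpha> r x \<in> sphere 0 1"
proof -
  obtain i where i: "x $ i \<noteq> 0" using \<open>x \<noteq> 0\<close> by (auto simp: vec_eq_iff)
  \<comment> \<open>A single nonzero coordinate suffices:
    \<open>R * \<bar>x $ i\<bar> \<ge> 1\<close> by the second argument of \<open>max\<close>, and
    \<open>R ^ \<alpha> i \<ge> R\<close> by the first.\<close>
  define R where "R = max 1 (1 / \<bar>x $ i\<bar>)"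
  have "1 \<le> R * \<bar>x $ i\<bar>"
    using i by (auto simp: R_def max_def field_simps)
  also have "\<dots> \<le> R ^ \<alpha> i * \<bar>x $ i\<bar>"
    using assms(1)[of i] by (intro mult_right_mono self_le_power) (auto simp: R_def)
  also have "\<dots> = \<bar>qh_scale \<alpha> R x $ i\<bar>"
    by (simp add: abs_mult R_def power_abs)
  also have "\<dots> \<le> norm (qh_scale \<alpha> R x)" by (rule component_le_norm_cart)
  finally have 1: "1 \<le> norm (qh_scale \<alpha> R x)" .
  have "\<alpha> i \<noteq> 0" for i using assms(1)[of i] by simp
  then have 0: "qh_scale \<alpha> 0 x = 0" by (simp add: vec_eq_iff)
  have "\<exists>r\<ge>0. r \<le> R \<and> norm (qh_scale \<alpha> r x) = 1"
    by (rule IVT') (use 0 1 in \<open>auto intro!: continuous_intros simp: R_def\<close>)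
  then obtain r where r: "r \<ge> 0" "norm (qh_scale \<alpha> r x) = 1" by blast
  with 0 have "r \<noteq> 0" by auto
  with r show thesis by (intro that[of r]) auto
qed

text \<open>By induction over polynomial functions. Continuity of the coefficients in
  \<open>x\<close> is what later allows the rescaled field to be extended to the horizon term by
  term.\<close>

lemma real_polynomial_function_qh_scale:
  fixes h :: "real^'n::finite \<Rightarrow> real"
  assumes "real_polynomial_function h"
  shows "\<exists>Q. (\<forall>m. continuous_on UNIV (\<lambda>x. coeff (Q x) m)) \<and>
    (\<forall>r x. h (qh_scale \<alpha> r x) = poly (Q x) r)"
  using assms
proof induction
  case (linear h)
  let ?Q = "\<lambda>x. \<Sum>i\<in>UNIV. monom (x $ i * h (axis i 1)) (\<alpha> i)"
  interpret bounded_linear h by fact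
  have "h (qh_scale \<alpha> r x) = poly (?Q x) r" for r x
  proof -
    have "h (qh_scale \<alpha> r x) = h (\<Sum>i\<in>UNIV. qh_scale \<alpha> r x $ i *\<^sub>R axis i 1)"
      using basis_expansion[of "qh_scale \<alpha> r x"] by (simp only: scalar_mult_eq_scaleR)
    also have "\<dots> = poly (?Q x) r"
      by (simp add: sum scale poly_sum poly_monom mult_ac)
    finally show ?thesis .
  qed
  moreover have "continuous_on UNIV (\<lambda>x. coeff (?Q x) m)" for m
  proof -
    have "continuous_on UNIV (\<lambda>x::real^'n. if \<alpha> i = m then x $ i * h (axis i 1) else 0)" for i
      by (cases "\<alpha> i = m") (auto intro!: continuous_intros)
    then show ?thesis
      unfolding coeff_sum coeff_monom by (intro continuous_intros) auto
  qed
  ultimately show ?case by (intro exI[of _ ?Q]) blast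
next
  case (const a)
  show ?case by (intro exI[of _ "\<lambda>_. [:a:]"]) auto
next
  case (add h1 h2)
  then obtain Q1 Q2 where
    "\<forall>m. continuous_on UNIV (\<lambda>x. coeff (Q1 x) m)" "\<forall>r x. h1 (qh_scale \<alpha> r x) = poly (Q1 x) r"
    "\<forall>m. continuous_on UNIV (\<lambda>x. coeff (Q2 x) m)" "\<forall>r x. h2 (qh_scale \<alpha> r x) = poly (Q2 x) r"
    by blast
  then show ?case
    by (intro exI[of _ "\<lambda>x. Q1 x + Q2 x"]) (auto intro!: continuous_intros)
next
  case (mult h1 h2)
  then obtain Q1 Q2 where
    "\<forall>m. continuous_on UNIV (\<lambda>x. coeff (Q1 x) m)" "\<forall>r x. h1 (qh_scale \<alpha> r x) = poly (Q1 x) r"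
    "\<forall>m. continuous_on UNIV (\<lambda>x. coeff (Q2 x) m)" "\<forall>r x. h2 (qh_scale \<alpha> r x) = poly (Q2 x) r"
    by blast
  then show ?case
    by (intro exI[of _ "\<lambda>x. Q1 x * Q2 x"]) (auto intro!: continuous_intros simp: coeff_mult)
qed

text \<open>If the degree exceeded \<open>d\<close>, dividing further by
  \<open>r ^ (degree q - d)\<close> would force \<open>poly q r / r ^ degree q\<close> to 0, yet its
  limit is the leading coefficient.\<close>

lemma degree_le_if_poly_over_power_convergent:
  fixes q :: "real poly"
  assumes lim: "((\<lambda>r. poly q r / r ^ d) \<longlongrightarrow> L) at_top"
  shows "degree q \<le> d"
proof (rule ccontr)
  assume "\<not> degree q \<le> d"
  then have deg: "d < degree q" by simp
  have "((\<lambda>r. inverse (r ^ (degree q - d))) \<longlongrightarrow> (0::real)) at_top"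
    by (rule tendsto_inverse_0_at_top)
      (use deg in \<open>auto intro!: filterlim_pow_at_top filterlim_ident\<close>)
  from tendsto_mult[OF lim this]
  have "((\<lambda>r. poly q r / r ^ d * inverse (r ^ (degree q - d))) \<longlongrightarrow> 0) at_top" by simp
  moreover have "\<forall>\<^sub>F r in at_top. poly q r / r ^ d * inverse (r ^ (degree q - d)) =
      poly q r / r ^ degree q"
  proof (rule always_eventually, rule allI)
    fix r :: real
    have "r ^ degree q = r ^ d * r ^ (degree q - d)"
      using deg by (simp flip: power_add)
    then show "poly q r / r ^ d * inverse (r ^ (degree q - d)) = poly q r / r ^ degree q"
      by (simp add: field_simps)
  qed
  ultimately have "((\<lambda>r. poly q r / r ^ degree q) \<longlongrightarrow> 0) at_top"
    by (rule Lim_transform_eventually)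
  moreover have "((\<lambda>r. poly q r / r ^ degree q) \<longlongrightarrow> lead_coeff q) at_top"
    using poly_divide_tendsto_aux[of q] at_top_le_at_infinity by (rule tendsto_mono[rotated])
  ultimately have "lead_coeff q = 0" using tendsto_unique trivial_limit_at_top_linorder by blast
  with deg show False by simp
qed

section \<open>Gluing and end behaviour\<close>

text \<open>At points of \<open>D\<close> only \<open>u\<close> matters because \<open>D\<close> is
  open. At points of \<open>E\<close> the limits within \<open>D\<close> and within \<open>E\<close>
  agree, and \<open>Lim_Un\<close> joins them.\<close>

lemma continuous_on_glue:
  fixes u v :: "'a::t2_space \<Rightarrow> 'b::topological_space"
  assumes "open D" "continuous_on D u" "continuous_on E v" "D \<inter> E = {}"
    and lim: "\<And>x. x \<in> E \<Longrightarrow> (u \<longlongrightarrow> v x) (at x within D)"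
  shows "continuous_on (D \<union> E) (\<lambda>x. if x \<in> D then u x else v x)" (is "continuous_on _ ?w")
  unfolding continuous_on_def
proof
  fix x assume "x \<in> D \<union> E"
  then show "(?w \<longlongrightarrow> ?w x) (at x within (D \<union> E))"
  proof
    assume x: "x \<in> D"
    have "(u \<longlongrightarrow> u x) (at x)"
      using continuous_on_eq_continuous_at[OF assms(1)] assms(2) x by (auto simp: isCont_def)
    moreover have "\<forall>\<^sub>F z in at x. u z = ?w z"
      using eventually_at_topological \<open>open D\<close> x by fastforce
    ultimately have "(?w \<longlongrightarrow> u x) (at x)" by (rule Lim_transform_eventually)
    then show ?thesis using x by (auto intro: tendsto_within_subset)
  next
    assume x: "x \<in> E"
    have "(?w \<longlongrightarrow> v x) (at x within D)"
      by (rule Lim_transform_eventually[OF lim[OF x]]) (auto simp: eventually_at_filter)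
    moreover have "(v \<longlongrightarrow> v x) (at x within E)"
      using assms(3) x by (simp add: continuous_on_def)
    then have "(?w \<longlongrightarrow> v x) (at x within E)"
      by (rule Lim_transform_eventually) (use assms(4) in \<open>auto simp: eventually_at_filter intro!: always_eventually\<close>)
    ultimately show ?thesis using x assms(4) by (auto intro: Lim_Un)
  qed
qed

text \<open>Density of the reals in the extended reals treats finite and infinite ends alike. The
  point \<open>s\<close> lies strictly beyond the threshold, so \<open>P\<close> holds at
  \<open>s\<close> itself.\<close>

lemma eventually_to_right_endE:
  assumes "a < b" and "eventually P (to_right_end b)"
  obtains s where "a < ereal s" "ereal s < b" "\<And>t. s \<le> t \<Longrightarrow> ereal t < b \<Longrightarrow> P t"
proof -
  obtain z where z: "z < b" and P: "\<And>w. z < w \<Longrightarrow> w < b \<Longrightarrow> P (real_of_ereal w)"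
    using assms(2) eventually_at_left[OF \<open>a < b\<close>]
    by (auto simp: to_right_end_def eventually_filtermap)
  obtain s where s: "max a z < ereal s" "ereal s < b"
    using ereal_dense2[of "max a z" b] z \<open>a < b\<close> by auto
  have "P t" if "s \<le> t" "ereal t < b" for t
    using P[of "ereal t"] that s(1) order_less_le_trans[of z "ereal s" "ereal t"] by auto
  with s show thesis by (intro that) auto
qed

lemma eventually_to_left_endE:
  assumes "a < b" and "eventually P (to_left_end a)"
  obtains s where "a < ereal s" "ereal s < b" "\<And>t. t \<le> s \<Longrightarrow> a < ereal t \<Longrightarrow> P t"
proof -
  obtain z where z: "a < z" and P: "\<And>w. a < w \<Longrightarrow> w < z \<Longrightarrow> P (real_of_ereal w)"
    using assms(2) eventually_at_right[OF \<open>a < b\<close>]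
    by (auto simp: to_left_end_def eventually_filtermap)
  obtain s where s: "a < ereal s" "ereal s < min b z"
    using ereal_dense2[of a "min b z"] z \<open>a < b\<close> by auto
  have "P t" if "t \<le> s" "a < ereal t" for t
    using P[of "ereal t"] that s(2) order_le_less_trans[of "ereal t" "ereal s" z] by auto
  with s show thesis by (intro that) auto
qed

text \<open>Near the right end \<open>v - u\<close> is nondecreasing, near the left end
  \<open>v + u\<close> is. As \<open>v\<close> is bounded there, \<open>u\<close> is bounded
  above.\<close>

lemma not_at_top_if_deriv_dominated:
  fixes u v u' v' :: "real \<Rightarrow> real" and a b :: ereal
  assumes ab: "a < b" and F: "F = to_right_end b \<or> F = to_left_end a"
    and u: "\<And>t. t \<in> einterval a b \<Longrightarrow> (u has_real_derivative u' t) (at t)"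
    and v: "\<And>t. t \<in> einterval a b \<Longrightarrow> (v has_real_derivative v' t) (at t)"
    and dom: "\<forall>\<^sub>F t in F. \<bar>u' t\<bar> \<le> v' t"
    and lim: "(v \<longlongrightarrow> L) F"
  shows "\<not> filterlim u at_top F"
proof
  assume top: "filterlim u at_top F"
  have "\<forall>\<^sub>F t in F. \<bar>v t\<bar> < \<bar>L\<bar> + 1"
    using order_tendstoD(2)[OF tendsto_rabs[OF lim]] by simp
  with dom have ev: "\<forall>\<^sub>F t in F. \<bar>u' t\<bar> \<le> v' t \<and> \<bar>v t\<bar> < \<bar>L\<bar> + 1"
    by eventually_elim simp
  from F show False
  proof
    assume F: "F = to_right_end b"
    obtain s where s: "a < ereal s" "ereal s < b"
      and P: "\<And>t. s \<le> t \<Longrightarrow> ereal t < b \<Longrightarrow> \<bar>u' t\<bar> \<le> v' t \<and> \<bar>v t\<bar> < \<bar>L\<bar> + 1"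
      using eventually_to_right_endE[OF ab ev[unfolded F]] by blast
    \<comment> \<open>The threshold exceeds what \<open>v\<close> can gain: monotonicity will give
      \<open>u t - u s \<le> v t - v s < 2 * (\<bar>L\<bar> + 1)\<close>.\<close>
    obtain s' where s': "a < ereal s'" "ereal s' < b"
      and Q: "\<And>t. s' \<le> t \<Longrightarrow> ereal t < b \<Longrightarrow> u t > u s + 2 * (\<bar>L\<bar> + 1)"
      using eventually_to_right_endE[OF ab] top[unfolded F filterlim_at_top_dense] by blast
    define t where "t = max s s'"
    have t: "s \<le> t" "s' \<le> t" "ereal t < b" using s s' by (auto simp: t_def max_def)
    have "v s - u s \<le> v t - u t"
    proof (rule DERIV_nonneg_imp_nondecreasing[OF \<open>s \<le> t\<close>])
      fix r assume r: "s \<le> r" "r \<le> t"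
      then have rb: "ereal r < b" "a < ereal r"
        using t(3) s(1) order_le_less_trans[of "ereal r" "ereal t" b]
          order_less_le_trans[of a "ereal s" "ereal r"] by auto
      then have "((\<lambda>x. v x - u x) has_real_derivative v' r - u' r) (at r)"
        by (intro DERIV_diff u v) (auto simp: einterval_def)
      with P[OF r(1) rb(1)]
      show "\<exists>y. ((\<lambda>x. v x - u x) has_real_derivative y) (at r) \<and> 0 \<le> y"
        by (intro exI[of _ "v' r - u' r"]) auto
    qed
    then show False using P[of s] P[of t] Q[of t] t s by auto
  next
    assume F: "F = to_left_end a"
    obtain s where s: "a < ereal s" "ereal s < b"
      and P: "\<And>t. t \<le> s \<Longrightarrow> a < ereal t \<Longrightarrow> \<bar>u' t\<bar> \<le> v' t \<and> \<bar>v t\<bar> < \<bar>L\<bar> + 1"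
      using eventually_to_left_endE[OF ab ev[unfolded F]] by blast
    obtain s' where s': "a < ereal s'" "ereal s' < b"
      and Q: "\<And>t. t \<le> s' \<Longrightarrow> a < ereal t \<Longrightarrow> u t > u s + 2 * (\<bar>L\<bar> + 1)"
      using eventually_to_left_endE[OF ab] top[unfolded F filterlim_at_top_dense] by blast
    define t where "t = min s s'"
    have t: "t \<le> s" "t \<le> s'" "a < ereal t" using s s' by (auto simp: t_def min_def)
    \<comment> \<open>Now \<open>t\<close> lies to the left of \<open>s\<close>, so the sum replaces
      the difference and bounds \<open>u t - u s\<close> by \<open>v s - v t\<close>.\<close>
    have "v t + u t \<le> v s + u s"
    proof (rule DERIV_nonneg_imp_nondecreasing[OF \<open>t \<le> s\<close>])
      fix r assume r: "t \<le> r" "r \<le> s"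
      then have rb: "a < ereal r" "ereal r < b"
        using t(3) s(2) order_le_less_trans[of "ereal r" "ereal s" b]
          order_less_le_trans[of a "ereal t" "ereal r"] by auto
      then have "((\<lambda>x. v x + u x) has_real_derivative v' r + u' r) (at r)"
        by (intro DERIV_add u v) (auto simp: einterval_def)
      with P[OF r(2) rb(1)]
      show "\<exists>y. ((\<lambda>x. v x + u x) has_real_derivative y) (at r) \<and> 0 \<le> y"
        by (intro exI[of _ "v' r + u' r"]) auto
    qed
    then show False using P[of s] P[of t] Q[of t] t s by auto
  qed
qed


section \<open>The compactification and its inverse\<close>

locale qh_compactification =
  fixes \<alpha> \<beta> :: "'n::finite \<Rightarrow> nat" and c :: nat and \<kappa> :: "real^'n \<Rightarrow> real"
  assumes \<alpha>_pos: "\<And>i. \<alpha> i \<ge> 1" and \<beta>_pos: "\<And>i. \<beta> i \<ge> 1" and c_pos: "c \<ge> 1"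
    and \<alpha>\<beta>: "\<And>i. \<alpha> i * \<beta> i = c"
    and adm: "admissible_compactification \<alpha> \<beta> c \<kappa>"
begin

abbreviation "p \<equiv> qh_p \<beta> c"
abbreviation "D \<equiv> qh_domain \<beta> c"
abbreviation "E \<equiv> horizon \<beta> c"
abbreviation "T \<equiv> qh_map \<alpha> \<kappa>"

section \<open>Basic consequences of admissibility\<close>

lemmas p_scale = qh_p_scale[of \<alpha> \<beta> c, OF \<alpha>\<beta> c_pos]
lemmas E_eq = horizon_eq[of \<alpha> \<beta> c, OF \<alpha>\<beta> c_pos]

lemma closure_D: "closure D = D \<union> E"
  unfolding closure_qh_domain[of \<alpha> \<beta> c, OF \<alpha>\<beta> c_pos] E_eq by (auto simp: qh_domain_def)

lemma D_Int_E: "D \<inter> E = {}"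
  unfolding E_eq by (auto simp: qh_domain_def)

lemma open_D: "open D"
  unfolding qh_domain_def by (intro open_Collect_less continuous_on_qh_p continuous_intros)

lemma p_nonneg: "p y \<ge> 0"
  unfolding qh_p_def using c_pos by (intro real_root_ge_zero sum_nonneg) auto

lemma \<kappa>_gt_p: "\<kappa> y > p y"
  using adm by (auto simp: admissible_compactification_def)

lemma \<kappa>_pos: "\<kappa> y > 0"
  using \<kappa>_gt_p[of y] p_nonneg[of y] by linarith

lemma \<kappa>_neq_0 [simp]: "\<kappa> y \<noteq> 0"
  using \<kappa>_pos[of y] by simp

lemma \<kappa>_asymp: "\<kappa> \<sim>[p_at_top \<beta> c] p"
  using adm by (auto simp: admissible_compactification_def)

lemma gradient_asymp:
  "(\<lambda>y. gradient \<kappa> y $ i) \<sim>[p_at_top \<beta> c]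
    (\<lambda>y. 1 / real (\<alpha> i) * ((y $ i) ^ (2 * \<beta> i - 1) / p y ^ (2 * c - 1)))"
  using adm by (auto simp: admissible_compactification_def)

lemma gradient_lt: "(\<chi> i. real (\<alpha> i) * y $ i) \<bullet> gradient \<kappa> y < \<kappa> y"
  using adm by (auto simp: admissible_compactification_def)

lemma has_derivative_\<kappa>: "(\<kappa> has_derivative (\<lambda>h. h \<bullet> gradient \<kappa> y)) (at y)"
  using adm GDERIV_gradient[of \<kappa> y]
  by (auto simp: admissible_compactification_def C1_function_def gderiv_def)

lemma continuous_on_gradient: "continuous_on S (gradient \<kappa>)"
  using adm continuous_on_subset
  by (fastforce simp: admissible_compactification_def C1_function_def)

lemma continuous_on_\<kappa>: "continuous_on S \<kappa>"
  using has_derivative_continuous[OF has_derivative_\<kappa>]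
  by (simp add: continuous_at_imp_continuous_on)

lemma continuous_on_T: "continuous_on S T"
  unfolding qh_map_def by (intro continuous_intros continuous_on_\<kappa>) simp

lemma T_eq_scale: "T y = qh_scale \<alpha> (1 / \<kappa> y) y"
  by (simp add: vec_eq_iff qh_map_def power_divide)

lemma scale_T: "qh_scale \<alpha> (\<kappa> y) (T y) = y"
  using \<kappa>_pos[of y] by (simp add: T_eq_scale qh_scale_mult)

lemma p_T: "p (T y) = p y / \<kappa> y"
  using \<kappa>_pos[of y] by (simp add: T_eq_scale p_scale)

lemma T_in_D: "T y \<in> D"
  using \<kappa>_gt_p[of y] \<kappa>_pos[of y] by (simp add: qh_domain_def p_T)

section \<open>Monotonicity along scaling orbits and injectivity\<close>

lemma has_derivative_\<kappa>_scale:
  assumes "r > 0"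
  shows "((\<lambda>r. \<kappa> (qh_scale \<alpha> r x)) has_real_derivative
    ((\<chi> i. real (\<alpha> i) * qh_scale \<alpha> r x $ i) \<bullet> gradient \<kappa> (qh_scale \<alpha> r x)) / r) (at r)"
proof -
  have power: "r ^ \<alpha> i = r * r ^ (\<alpha> i - 1)" for i
    using \<alpha>_pos[of i] by (simp add: power_eq_if)
  have "((\<lambda>r. r ^ \<alpha> i * x $ i) has_real_derivative real (\<alpha> i) * qh_scale \<alpha> r x $ i / r) (at r)" for i
    by (rule derivative_eq_intros refl)+ (use assms in \<open>simp add: power[of i]\<close>)
  then have "((\<lambda>r. qh_scale \<alpha> r x) has_vector_derivative
      (\<chi> i. real (\<alpha> i) * qh_scale \<alpha> r x $ i / r)) (at r)"
    unfolding qh_scale_def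
    by (intro has_vector_derivative_vec_lambda) (simp add: has_real_derivative_iff_has_vector_derivative)
  \<comment> \<open>The velocity of the orbit has components
    \<open>\<alpha> i * qh_scale \<alpha> r x $ i / r\<close>, so the chain rule produces the inner
    product of \<open>gradient_lt\<close>.\<close>
  from vector_derivative_diff_chain_within[OF this has_derivative_at_withinI[OF has_derivative_\<kappa>]]
  show ?thesis
    by (simp add: o_def has_real_derivative_iff_has_vector_derivative inner_vec_def
        sum_divide_distrib)
qed

text \<open>The numerator of the derivative is the inner product of \<open>gradient_lt\<close> minus
  \<kappa>, hence negative.\<close>

lemma \<kappa>_scale_over_decreasing:
  assumes "0 < r" "r < s"
  shows "\<kappa> (qh_scale \<alpha> s x) / s < \<kappa> (qh_scale \<alpha> r x) / r"
proof (rule DERIV_neg_imp_decreasing[OF \<open>r < s\<close>])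
  fix t assume "r \<le> t" "t \<le> s"
  with assms have t: "t > 0" by simp
  let ?y = "qh_scale \<alpha> t x"
  let ?d = "(\<chi> i. real (\<alpha> i) * ?y $ i) \<bullet> gradient \<kappa> ?y"
  have "((\<lambda>t. \<kappa> (qh_scale \<alpha> t x) / t) has_real_derivative (?d - \<kappa> ?y) / (t * t)) (at t)"
    by (rule derivative_eq_intros has_derivative_\<kappa>_scale[OF t] refl)+ (use t in simp_all)
  moreover have "(?d - \<kappa> ?y) / (t * t) < 0"
    using gradient_lt[of ?y] t by (intro divide_neg_pos) auto
  ultimately show "\<exists>y. ((\<lambda>t. \<kappa> (qh_scale \<alpha> t x) / t) has_real_derivative y) (at t) \<and> y < 0"
    by blast
qed

text \<open>If \<open>T y = x\<close>, then by \<open>scale_T\<close> the quotient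
  \<open>\<kappa> (qh_scale \<alpha> r x) / r\<close> equals 1 at \<open>r = \<kappa> y\<close>.
  Strict decrease leaves only one such \<open>r\<close>, and \<open>y\<close> is recovered from
  \<open>x\<close> and \<open>r\<close>.\<close>

lemma inj_T: "inj T"
proof (rule injI)
  fix y z assume eq: "T y = T z"
  have "\<not> \<kappa> y < \<kappa> z" if "T y = T z" for y z
  proof
    assume "\<kappa> y < \<kappa> z"
    from \<kappa>_scale_over_decreasing[OF \<kappa>_pos this, of "T y"]
    have "\<kappa> (qh_scale \<alpha> (\<kappa> z) (T z)) / \<kappa> z < \<kappa> (qh_scale \<alpha> (\<kappa> y) (T y)) / \<kappa> y"
      by (simp only: that)
    then show False by (simp add: scale_T)
  qed
  from this[OF eq] this[OF eq[symmetric]] have "\<kappa> y = \<kappa> z" by simp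
  then show "y = z" using scale_T[of y] scale_T[of z] eq by metis
qed

section \<open>Surjectivity onto the domain and continuity of the inverse\<close>

lemma inv_T_T [simp]: "inv T (T y) = y"
  by (simp add: inj_T)

text \<open>A preimage of \<open>x\<close> is sought on its scaling orbit: any \<open>r\<close> with
  \<open>\<kappa> (qh_scale \<alpha> r x) = r\<close> gives one, and the intermediate value theorem
  provides it.\<close>

lemma range_T: "range T = D"
proof
  show "range T \<subseteq> D" using T_in_D by auto
  show "D \<subseteq> range T"
  proof
    fix x assume x: "x \<in> D"
    \<comment> \<open>This is the upper end for the intermediate value theorem. If
      \<open>p x > 0\<close>, then \<kappa> grows like \<open>s * p x\<close> along the orbit,
      slower than \<open>s\<close> because \<open>p x < 1\<close>; otherwise \<open>x = 0\<close>
      and the orbit is constant.\<close>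
    have "\<exists>s>0. \<kappa> (qh_scale \<alpha> s x) \<le> s"
    proof (cases "p x = 0")
      case True
      have "x = 0"
      proof -
        have "(\<Sum>i\<in>UNIV. (x $ i) ^ (2 * \<beta> i)) = 0"
          using True c_pos by (simp add: qh_p_def)
        then have "\<forall>i. (x $ i) ^ (2 * \<beta> i) = 0"
          by (subst (asm) sum_nonneg_eq_0_iff) auto
        then show ?thesis by (simp add: vec_eq_iff)
      qed
      then have "qh_scale \<alpha> (\<kappa> 0) x = 0" by (simp add: vec_eq_iff)
      then show ?thesis using \<kappa>_pos[of 0] by (intro exI[of _ "\<kappa> 0"]) simp
    next
      case False
      with p_nonneg[of x] have px: "p x > 0" by simp
      have "filterlim (\<lambda>s. s * p x) at_top at_top"
        using px by (rule filterlim_tendsto_pos_mult_at_top[OF tendsto_const _ filterlim_ident, simplified mult.commute])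
      then have "filterlim (\<lambda>s. p (qh_scale \<alpha> s x)) at_top at_top"
        by (rule filterlim_mono_eventually[OF _ order_refl order_refl])
          (auto simp: p_scale intro: eventually_mono[OF eventually_ge_at_top[of 0]])
      then have lim: "filterlim (\<lambda>s. qh_scale \<alpha> s x) (p_at_top \<beta> c) at_top"
        by (simp add: p_at_top_def filterlim_filtercomap_iff o_def)
      obtain \<epsilon> where \<epsilon>: "(\<epsilon> \<longlongrightarrow> 0) (p_at_top \<beta> c)"
          "\<forall>\<^sub>F y in p_at_top \<beta> c. \<kappa> y = (1 + \<epsilon> y) * p y"
        using \<kappa>_asymp by (auto simp: asymp_equiv_iff_relative_error)
      \<comment> \<open>This gap absorbs the relative error: eventually
        \<open>1 + \<epsilon> y < 1 / p x\<close>, and \<open>p\<close> of the scaled point is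
        \<open>s * p x\<close>.\<close>
      have "1 / p x - 1 > 0" using px x by (simp add: qh_domain_def)
      with \<epsilon>(1) have "\<forall>\<^sub>F y in p_at_top \<beta> c. \<epsilon> y < 1 / p x - 1"
        by (rule order_tendstoD)
      with \<epsilon>(2) have "\<forall>\<^sub>F y in p_at_top \<beta> c. \<kappa> y \<le> 1 / p x * p y"
      proof eventually_elim
        case (elim y)
        then show ?case using p_nonneg[of y] by (simp only:) (intro mult_right_mono, auto)
      qed
      from eventually_compose_filterlim[OF this lim] eventually_gt_at_top[of 0]
      have "\<forall>\<^sub>F s in at_top. s > 0 \<and> \<kappa> (qh_scale \<alpha> s x) \<le> s"
        by eventually_elim (use px in \<open>simp add: p_scale\<close>)
      then show ?thesis
        using eventually_happens trivial_limit_at_top_linorder by blast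
    qed
    then obtain s where s: "s > 0" "\<kappa> (qh_scale \<alpha> s x) \<le> s" by blast
    have "continuous_on {0..s} (\<lambda>r. r - \<kappa> (qh_scale \<alpha> r x))"
      by (intro continuous_intros continuous_on_compose2[OF continuous_on_\<kappa>[of UNIV]]) simp
    then have "\<exists>r\<ge>0. r \<le> s \<and> r - \<kappa> (qh_scale \<alpha> r x) = 0"
      using s \<kappa>_pos[of "qh_scale \<alpha> 0 x"] by (intro IVT') simp_all
    then obtain r where "r - \<kappa> (qh_scale \<alpha> r x) = 0" by blast
    then have r: "\<kappa> (qh_scale \<alpha> r x) = r" by linarith
    then have "r > 0" using \<kappa>_pos[of "qh_scale \<alpha> r x"] by simp
    then have "T (qh_scale \<alpha> r x) = x" by (simp add: T_eq_scale qh_scale_mult r)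
    then show "x \<in> range T" by (metis rangeI)
  qed
qed

lemma T_inv_T: "x \<in> D \<Longrightarrow> T (inv T x) = x"
  by (simp add: f_inv_into_f range_T)

lemma continuous_on_inv_T: "continuous_on D (inv T)"
proof -
  obtain g where g: "homeomorphism UNIV (T ` UNIV) T g"
    by (rule invariance_of_domain_homeomorphism[of UNIV T])
      (use inj_T in \<open>auto intro: continuous_on_T\<close>)
  then have "continuous_on D g" and g_T: "\<And>y. g (T y) = y"
    by (auto simp: homeomorphism_def range_T)
  moreover have "inv T x = g x" if "x \<in> D" for x
    using g_T[of "inv T x"] T_inv_T[OF that] by simp
  ultimately show ?thesis
    using continuous_on_cong[of D D "inv T" g] by simp
qed

section \<open>Blow-up of the inverse at the horizon\<close>

lemma bounded_sublevel_p: "{y. p y \<le> R} \<subseteq> cball 0 (real CARD('n) * (1 + R ^ (2 * c)))"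
proof
  fix y assume "y \<in> {y. p y \<le> R}"
  then have y: "p y ^ (2 * c) \<le> R ^ (2 * c)"
    using p_nonneg by (intro power_mono) auto
  have p: "p y ^ (2 * c) = (\<Sum>i\<in>UNIV. (y $ i) ^ (2 * \<beta> i))"
    unfolding qh_p_def using c_pos by (subst real_root_pow_pos2) (auto intro: sum_nonneg)
  \<comment> \<open>A coordinate of modulus at least 1 is bounded by its own summand of
    \<open>p y ^ (2 * c)\<close>; the added 1 covers the other coordinates.\<close>
  have "\<bar>y $ i\<bar> \<le> 1 + R ^ (2 * c)" for i
  proof (cases "\<bar>y $ i\<bar> \<ge> 1")
    case True
    then have "\<bar>y $ i\<bar> \<le> \<bar>y $ i\<bar> ^ (2 * \<beta> i)"
      using \<beta>_pos[of i] by (intro self_le_power) auto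
    also have "\<dots> = (y $ i) ^ (2 * \<beta> i)" by (simp add: power_mult)
    also have "\<dots> \<le> (\<Sum>i\<in>UNIV. (y $ i) ^ (2 * \<beta> i))"
      by (rule member_le_sum) auto
    also have "\<dots> \<le> R ^ (2 * c)" using y p by simp
    finally show ?thesis by simp
  next
    case False
    then show ?thesis using order_trans[OF zero_le_power[OF p_nonneg] y] by linarith
  qed
  then have "(\<Sum>i\<in>UNIV. \<bar>y $ i\<bar>) \<le> (\<Sum>i\<in>(UNIV::'n set). 1 + R ^ (2 * c))"
    by (rule sum_mono)
  with norm_le_l1_cart[of y] show "y \<in> cball 0 (real CARD('n) * (1 + R ^ (2 * c)))"
    by simp
qed

text \<open>The image of a ball under \<open>T\<close> is a compact subset of \<open>D\<close>, so
  it misses a neighbourhood of the horizon point. Points of \<open>D\<close> in that neighbourhood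
  come from outside the ball, which contains the sublevel set of \<open>p\<close>.\<close>

lemma p_inv_T_at_top:
  assumes "x \<in> E"
  shows "filterlim (\<lambda>z. p (inv T z)) at_top (at x within D)"
  unfolding filterlim_at_top
proof
  fix R :: real
  let ?K = "T ` cball 0 (real CARD('n) * (1 + R ^ (2 * c)))"
  have "compact ?K" by (intro compact_continuous_image continuous_on_T) auto
  moreover have "x \<notin> ?K" using assms D_Int_E T_in_D by auto
  ultimately have "\<forall>\<^sub>F z in at x. z \<notin> ?K"
    by (auto simp: eventually_at_topological intro!: exI[of _ "- ?K"] compact_imp_closed)
  then have "\<forall>\<^sub>F z in at x within D. z \<notin> ?K \<and> z \<in> D"
    by (auto simp: eventually_at_filter elim: eventually_mono)
  then show "\<forall>\<^sub>F z in at x within D. R \<le> p (inv T z)"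
  proof eventually_elim
    case (elim z)
    then have "inv T z \<notin> cball 0 (real CARD('n) * (1 + R ^ (2 * c)))"
      using T_inv_T[of z] by (metis imageI)
    with bounded_sublevel_p[of R] have "\<not> p (inv T z) \<le> R" by blast
    then show ?case by simp
  qed
qed

text \<open>The continuous extensions of \<open>1/\<kappa>\<close> and of \<open>(\<nabla>\<kappa>)\<^sub>j \<kappa> ^ (\<alpha>\<^sub>j - 1)\<close> to the closed domain; the boundary
  values of the latter come from (A2), in which the powers of \<open>\<kappa>\<close> cancel since \<open>\<alpha>\<^sub>j \<beta>\<^sub>j = c\<close>.\<close>

definition \<sigma> :: "real^'n \<Rightarrow> real" where
  "\<sigma> x = (if x \<in> D then 1 / \<kappa> (inv T x) else 0)"

definition W :: "'n \<Rightarrow> real^'n \<Rightarrow> real" where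
  "W j x = (if x \<in> D then gradient \<kappa> (inv T x) $ j * \<kappa> (inv T x) ^ (\<alpha> j - 1)
    else 1 / real (\<alpha> j) * (x $ j) ^ (2 * \<beta> j - 1))"

section \<open>Continuity of the extensions up to the horizon\<close>

lemma continuous_on_\<kappa>_inv_T: "continuous_on D (\<lambda>x. \<kappa> (inv T x))"
  by (rule continuous_on_compose2[OF continuous_on_\<kappa>[of UNIV] continuous_on_inv_T]) auto

lemma continuous_on_\<sigma>: "continuous_on (closure D) \<sigma>"
  unfolding closure_D \<sigma>_def
proof (rule continuous_on_glue[OF open_D _ _ D_Int_E])
  show "continuous_on D (\<lambda>x. 1 / \<kappa> (inv T x))"
    by (intro continuous_intros continuous_on_\<kappa>_inv_T) simp
next
  fix x assume "x \<in> E"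
  then have "filterlim (\<lambda>z. \<kappa> (inv T z)) at_top (at x within D)"
    using filterlim_at_top_mono[OF p_inv_T_at_top] \<kappa>_gt_p by (simp add: less_imp_le)
  then show "((\<lambda>z. 1 / \<kappa> (inv T z)) \<longlongrightarrow> 0) (at x within D)"
    using tendsto_inverse_0_at_top by (simp add: inverse_eq_divide)
qed simp

lemma continuous_on_W: "continuous_on (closure D) (W j)"
  unfolding closure_D W_def
proof (rule continuous_on_glue[OF open_D _ _ D_Int_E])
  have "continuous_on D (\<lambda>x. gradient \<kappa> (inv T x))"
    by (rule continuous_on_compose2[OF continuous_on_gradient[of UNIV] continuous_on_inv_T]) auto
  then show "continuous_on D (\<lambda>x. gradient \<kappa> (inv T x) $ j * \<kappa> (inv T x) ^ (\<alpha> j - 1))"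
    by (intro continuous_intros continuous_on_\<kappa>_inv_T)
next
  fix x assume x: "x \<in> E"
  then have px: "p x = 1" by (simp add: E_eq)
  let ?b = "\<lambda>y. 1 / real (\<alpha> j) * ((y $ j) ^ (2 * \<beta> j - 1) / p y ^ (2 * c - 1))"
  obtain \<epsilon> where \<epsilon>: "(\<epsilon> \<longlongrightarrow> 0) (p_at_top \<beta> c)"
      "\<forall>\<^sub>F y in p_at_top \<beta> c. gradient \<kappa> y $ j = (1 + \<epsilon> y) * ?b y"
    using gradient_asymp[of j] unfolding asymp_equiv_iff_relative_error by blast
  have lim: "filterlim (inv T) (p_at_top \<beta> c) (at x within D)"
    using p_inv_T_at_top[OF x] by (simp add: p_at_top_def filterlim_filtercomap_iff o_def)
  \<comment> \<open>With \<open>inv T z = qh_scale \<alpha> s z\<close>, the powers of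
    \<open>s\<close> in the numerator and in the extra factor cancel the power
    \<open>2 * c - 1\<close> in the denominator, so the comparison function depends on
    \<open>z\<close> alone.\<close>
  have scale: "?b (inv T z) * \<kappa> (inv T z) ^ (\<alpha> j - 1) = ?b z" if "z \<in> D" for z
  proof -
    define s where "s = \<kappa> (inv T z)"
    have s: "s > 0" by (simp add: s_def \<kappa>_pos)
    have y: "inv T z = qh_scale \<alpha> s z"
      using scale_T[of "inv T z"] T_inv_T[OF that] by (simp add: s_def)
    \<comment> \<open>The subtractions are truncated; \<open>\<alpha> j \<ge> 1\<close> and
      \<open>\<beta> j \<ge> 1\<close> make them exact.\<close>
    have "\<alpha> j * (2 * \<beta> j - 1) + (\<alpha> j - 1) = 2 * c - 1"
    proof -
      have "\<alpha> j * (2 * \<beta> j - 1) = 2 * (\<alpha> j * \<beta> j) - \<alpha> j" by (simp add: diff_mult_distrib2 mult_ac)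
      moreover have "\<alpha> j \<le> \<alpha> j * \<beta> j" using \<beta>_pos[of j] by simp
      ultimately show ?thesis using \<alpha>\<beta>[of j] \<alpha>_pos[of j] by linarith
    qed
    then have "s ^ (2 * c - 1) = (s ^ \<alpha> j) ^ (2 * \<beta> j - 1) * s ^ (\<alpha> j - 1)"
      by (simp flip: power_mult power_add)
    with s show ?thesis
      unfolding s_def[symmetric] unfolding y
      by (simp add: p_scale power_mult_distrib)
  qed
  have "((\<lambda>z. \<epsilon> (inv T z)) \<longlongrightarrow> 0) (at x within D)"
    using filterlim_compose[OF \<epsilon>(1) lim] .
  moreover have "(p \<longlongrightarrow> p x) (at x within D)"
    using continuous_on_qh_p[of UNIV] by (auto simp: continuous_on_def intro: tendsto_within_subset)
  ultimately have "((\<lambda>z. (1 + \<epsilon> (inv T z)) * ?b z) \<longlongrightarrow> (1 + 0) * ?b x) (at x within D)"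
    using px by (intro tendsto_intros) auto
  moreover have "\<forall>\<^sub>F z in at x within D. z \<in> D" by (simp add: eventually_at_filter)
  with eventually_compose_filterlim[OF \<epsilon>(2) lim]
  have "\<forall>\<^sub>F z in at x within D. (1 + \<epsilon> (inv T z)) * ?b z =
      gradient \<kappa> (inv T z) $ j * \<kappa> (inv T z) ^ (\<alpha> j - 1)"
  proof eventually_elim
    case (elim z)
    then show ?case using scale[of z] by (simp only: mult.assoc)
  qed
  ultimately show "((\<lambda>z. gradient \<kappa> (inv T z) $ j * \<kappa> (inv T z) ^ (\<alpha> j - 1))
      \<longlongrightarrow> 1 / real (\<alpha> j) * (x $ j) ^ (2 * \<beta> j - 1)) (at x within D)"
    by (rule Lim_transform_eventually[THEN tendsto_eq_rhs]) (simp add: px)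
qed (intro continuous_intros)

text \<open>\<open>F\<close> may be any function that is the rescaled field on \<open>D\<close>, so
  a continuous extension qualifies. The inner product of \<open>f (y t)\<close> with the gradient is
  \<open>\<kappa> (y t) ^ (k + 1)\<close> times the sum; dividing by \<kappa> gives the logarithmic
  derivative, and the quotient rule gives the desingularized equation.\<close>

lemma
  fixes f :: "real^'n \<Rightarrow> real^'n" and F :: "'n \<Rightarrow> real^'n \<Rightarrow> real"
  assumes F: "\<And>j x. x \<in> D \<Longrightarrow>
      F j x = f (qh_scale \<alpha> (\<kappa> (inv T x)) x) $ j / \<kappa> (inv T x) ^ (k + \<alpha> j)"
    and y: "(y has_vector_derivative f (y t)) (at t)"
  shows has_derivative_ln_\<kappa>_solution: "((\<lambda>t. ln (\<kappa> (y t))) has_real_derivative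
      \<kappa> (y t) ^ k * (\<Sum>j\<in>UNIV. W j (T (y t)) * F j (T (y t)))) (at t)"
    and has_derivative_T_solution: "((\<lambda>t. T (y t) $ i) has_real_derivative
      \<kappa> (y t) ^ k * (F i (T (y t)) - real (\<alpha> i) * T (y t) $ i *
        (\<Sum>j\<in>UNIV. W j (T (y t)) * F j (T (y t))))) (at t)"
proof -
  let ?S = "\<Sum>j\<in>UNIV. W j (T (y t)) * F j (T (y t))"
  let ?\<kappa> = "\<kappa> (y t)"
  have F_T: "F j (T (y t)) = f (y t) $ j / ?\<kappa> ^ (k + \<alpha> j)" for j
    using F[OF T_in_D] by (simp add: scale_T)
  have W_T: "W j (T (y t)) = gradient \<kappa> (y t) $ j * ?\<kappa> ^ (\<alpha> j - 1)" for j
    by (simp add: W_def T_in_D)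
  have "?\<kappa> ^ (k + 1) * (W j (T (y t)) * F j (T (y t))) = gradient \<kappa> (y t) $ j * f (y t) $ j" for j
  proof -
    have "?\<kappa> ^ (k + 1) * ?\<kappa> ^ (\<alpha> j - 1) = ?\<kappa> ^ (k + \<alpha> j)"
      using \<alpha>_pos[of j] by (simp flip: power_add power_Suc)
    then show ?thesis
      unfolding F_T W_T by (simp add: divide_simps)
  qed
  then have "f (y t) \<bullet> gradient \<kappa> (y t) = ?\<kappa> ^ (k + 1) * ?S"
    by (simp only: sum_distrib_left) (simp add: inner_vec_def mult.commute)
  with vector_derivative_diff_chain_within[OF y has_derivative_at_withinI[OF has_derivative_\<kappa>]]
  have \<kappa>': "((\<lambda>t. \<kappa> (y t)) has_real_derivative ?\<kappa> ^ (k + 1) * ?S) (at t)"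
    by (simp add: o_def has_real_derivative_iff_has_vector_derivative)
  have "((\<lambda>t. ln (\<kappa> (y t))) has_real_derivative inverse ?\<kappa> * (?\<kappa> ^ (k + 1) * ?S)) (at t)"
    using DERIV_chain2[OF DERIV_ln[OF \<kappa>_pos] \<kappa>'] .
  then show "((\<lambda>t. ln (\<kappa> (y t))) has_real_derivative ?\<kappa> ^ k * ?S) (at t)"
    by (rule DERIV_cong) simp
  have y': "((\<lambda>t. y t $ i) has_real_derivative f (y t) $ i) (at t)"
    using bounded_linear.has_vector_derivative[OF bounded_linear_vec_nth y]
    by (simp add: has_real_derivative_iff_has_vector_derivative)
  \<comment> \<open>Naming this factor keeps the truncated exponent out of the algebra
    below.\<close>
  define m where "m = ?\<kappa> ^ (\<alpha> i - 1)"
  have m: "m \<noteq> 0" and \<kappa>_power: "?\<kappa> ^ \<alpha> i = ?\<kappa> * m"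
    using \<alpha>_pos[of i] by (simp_all add: m_def flip: power_Suc)
  have "((\<lambda>t. y t $ i / \<kappa> (y t) ^ \<alpha> i) has_real_derivative
      (f (y t) $ i * ?\<kappa> ^ \<alpha> i - y t $ i * (real (\<alpha> i) * (?\<kappa> ^ (k + 1) * ?S * m))) /
        (?\<kappa> ^ \<alpha> i * ?\<kappa> ^ \<alpha> i)) (at t)"
    unfolding m_def by (rule derivative_eq_intros y' \<kappa>' refl | simp)+
  \<comment> \<open>An arbitrary \<open>s\<close> stands for the sum, so that simplification does
    not expand it.\<close>
  moreover have "(f (y t) $ i * ?\<kappa> ^ \<alpha> i - y t $ i * (real (\<alpha> i) * (?\<kappa> ^ (k + 1) * s * m))) /
      (?\<kappa> ^ \<alpha> i * ?\<kappa> ^ \<alpha> i) = ?\<kappa> ^ k * (F i (T (y t)) - real (\<alpha> i) * T (y t) $ i * s)" for s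
    using m unfolding F_T by (simp add: qh_map_def \<kappa>_power power_add field_simps)
  ultimately show "((\<lambda>t. T (y t) $ i) has_real_derivative
      ?\<kappa> ^ k * (F i (T (y t)) - real (\<alpha> i) * T (y t) $ i * ?S)) (at t)"
    by (simp only: qh_map_def vec_lambda_beta)
qed

end

section \<open>The desingularized field on the horizon\<close>

locale qh_vector_field = qh_compactification \<alpha> \<beta> c \<kappa>
  for \<alpha> \<beta> :: "'n::finite \<Rightarrow> nat" and c :: nat and \<kappa> :: "real^'n \<Rightarrow> real" +
  fixes k :: nat and f :: "real^'n \<Rightarrow> real^'n"
  assumes poly: "polynomial_function f" and asymp: "asymp_quasi_homogeneous \<alpha> k f"
begin

text \<open>The existence of a limit will bound the degree in \<open>r\<close>. A nonzero
  \<open>x\<close> is moved to the sphere, where the asymptotics give the limit, and substituting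
  \<open>r / s\<close> carries it back. The origin is fixed by scaling, so there a constant is
  divided by a growing power.\<close>

lemma rescaled_field_convergent:
  "\<exists>L. ((\<lambda>r. f (qh_scale \<alpha> r x) $ j / r ^ (k + \<alpha> j)) \<longlongrightarrow> L) at_top"
proof (cases "x = 0")
  case True
  then have "qh_scale \<alpha> r x = 0" for r by (simp add: vec_eq_iff)
  moreover have "((\<lambda>r. f 0 $ j / r ^ (k + \<alpha> j)) \<longlongrightarrow> 0) at_top"
    using \<alpha>_pos[of j]
    by (intro tendsto_divide_0[OF tendsto_const] filterlim_at_top_imp_at_infinity
        filterlim_pow_at_top filterlim_ident) simp
  ultimately show ?thesis by auto
next
  case False
  then obtain s where s: "s > 0" "qh_scale \<alpha> s x \<in> sphere 0 1"
    using exists_qh_scale_on_sphere[of \<alpha> x] \<alpha>_pos by blast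
  let ?u = "qh_scale \<alpha> s x"
  let ?d = "k + \<alpha> j"
  obtain h :: "real^'n \<Rightarrow> real^'n" where "uniform_limit (sphere 0 1)
      (\<lambda>r x. (f (qh_scale \<alpha> r x) $ j - r ^ ?d * h x $ j) / r ^ ?d) (\<lambda>x. 0) at_top"
    using asymp unfolding asymp_quasi_homogeneous_def by blast
  from tendsto_add[OF tendsto_uniform_limitI[OF this s(2)] tendsto_const[of "h ?u $ j"]]
  have "((\<lambda>r. (f (qh_scale \<alpha> r ?u) $ j - r ^ ?d * h ?u $ j) / r ^ ?d + h ?u $ j)
      \<longlongrightarrow> h ?u $ j) at_top" by simp
  moreover have "\<forall>\<^sub>F r in at_top. (f (qh_scale \<alpha> r ?u) $ j - r ^ ?d * h ?u $ j) / r ^ ?d + h ?u $ j =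
      f (qh_scale \<alpha> r ?u) $ j / r ^ ?d"
    using eventually_gt_at_top[of 0] by eventually_elim (simp add: diff_divide_distrib)
  ultimately have "((\<lambda>r. f (qh_scale \<alpha> r ?u) $ j / r ^ ?d) \<longlongrightarrow> h ?u $ j) at_top"
    by (rule Lim_transform_eventually)
  moreover have "filterlim (\<lambda>r. r * (1 / s)) at_top at_top"
    using s(1) by (subst filterlim_at_top_mult_tendsto_pos[OF tendsto_const]) (auto intro: filterlim_ident)
  ultimately have "((\<lambda>r. f (qh_scale \<alpha> (r * (1 / s)) ?u) $ j / (r * (1 / s)) ^ ?d) \<longlongrightarrow> h ?u $ j) at_top"
    by (rule filterlim_compose)
  then have "((\<lambda>r. f (qh_scale \<alpha> r x) $ j / r ^ ?d * s ^ ?d) \<longlongrightarrow> h ?u $ j) at_top"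
    using s(1) by (simp add: qh_scale_mult power_divide)
  from tendsto_mult[OF this tendsto_const[of "1 / s ^ ?d"]] s(1) show ?thesis by auto
qed

lemma continuous_extension_of_rescaled_field:
  obtains F :: "'n \<Rightarrow> real^'n \<Rightarrow> real"
  where "\<And>j. continuous_on (closure D) (F j)"
    and "\<And>j x. x \<in> D \<Longrightarrow>
      F j x = f (qh_scale \<alpha> (\<kappa> (inv T x)) x) $ j / \<kappa> (inv T x) ^ (k + \<alpha> j)"
proof -
  have "real_polynomial_function (\<lambda>x. f x $ j)" for j
    using poly bounded_linear_vec_nth[of j] unfolding polynomial_function_def o_def by blast
  then have "\<forall>j. \<exists>Q. (\<forall>m. continuous_on UNIV (\<lambda>x. coeff (Q x) m)) \<and>
      (\<forall>r x. f (qh_scale \<alpha> r x) $ j = poly (Q x) r)"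
    using real_polynomial_function_qh_scale by blast
  then obtain Q where Q: "\<And>j m. continuous_on UNIV (\<lambda>x. coeff (Q j x) m)"
      "\<And>j r x. f (qh_scale \<alpha> r x) $ j = poly (Q j x) r"
    by metis
  \<comment> \<open>The range ends at the fixed \<open>k + \<alpha> j\<close>, not at the degree,
    which may vary with \<open>x\<close>; so continuity is termwise. Where
    \<open>\<sigma> x = 0\<close> only the top summand survives.\<close>
  define F where "F j x = (\<Sum>m\<le>k + \<alpha> j. coeff (Q j x) m * \<sigma> x ^ (k + \<alpha> j - m))" for j x
  show thesis
  proof
    show "continuous_on (closure D) (F j)" for j
      unfolding F_def by (intro continuous_intros continuous_on_\<sigma> continuous_on_subset[OF Q(1)]) auto
    fix j x assume x: "x \<in> D"
    let ?\<kappa> = "\<kappa> (inv T x)"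
    let ?d = "k + \<alpha> j"
    have "degree (Q j x) \<le> ?d"
      using rescaled_field_convergent[of x j] unfolding Q(2)
      by (blast intro: degree_le_if_poly_over_power_convergent)
    then have "poly (Q j x) ?\<kappa> = (\<Sum>m\<le>?d. coeff (Q j x) m * ?\<kappa> ^ m)"
      unfolding poly_altdef by (intro sum.mono_neutral_left) (auto simp: coeff_eq_0)
    moreover have "?\<kappa> ^ m / ?\<kappa> ^ ?d = \<sigma> x ^ (?d - m)" if "m \<le> ?d" for m
    proof -
      have "?\<kappa> ^ ?d = ?\<kappa> ^ m * ?\<kappa> ^ (?d - m)"
        using that by (simp flip: power_add)
      then show ?thesis using x by (simp add: \<sigma>_def power_divide)
    qed
    ultimately show "F j x = f (qh_scale \<alpha> ?\<kappa> x) $ j / ?\<kappa> ^ ?d"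
      unfolding F_def Q(2) by (simp add: sum_divide_distrib flip: times_divide_eq_right)
  qed
qed

section \<open>Vanishing of the extended field at the limit direction\<close>

lemma limit_direction_is_equilibrium:
  assumes sol: "ode_solution_on f a b y"
    and end_filter: "F = to_right_end b \<or> F = to_left_end a"
    and dir: "tends_to_infinity_in_direction \<alpha> \<beta> c \<kappa> y x F"
  shows "\<exists>g. desing_extension \<alpha> \<beta> c k \<kappa> f g \<and> x \<in> E \<and> g x = 0"
proof -
  obtain \<phi> :: "'n \<Rightarrow> real^'n \<Rightarrow> real" where cont: "\<And>j. continuous_on (closure D) (\<phi> j)"
    and \<phi>: "\<And>j x. x \<in> D \<Longrightarrow>
      \<phi> j x = f (qh_scale \<alpha> (\<kappa> (inv T x)) x) $ j / \<kappa> (inv T x) ^ (k + \<alpha> j)"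
    using continuous_extension_of_rescaled_field by blast
  define S where "S x = (\<Sum>j\<in>UNIV. W j x * \<phi> j x)" for x
  \<comment> \<open>This is the desingularized formula with each factor replaced by its extension to
    the closed domain.\<close>
  define g where "g x = (\<chi> i. \<phi> i x - real (\<alpha> i) * x $ i * S x)" for x
  have S_cont: "continuous_on (closure D) S"
    unfolding S_def by (intro continuous_intros continuous_on_W cont)
  then have g_cont: "continuous_on (closure D) g"
    unfolding g_def by (intro continuous_intros cont)
  moreover have "g x = desing_field \<alpha> k \<kappa> f x" if "x \<in> D" for x
    using that by (simp add: g_def S_def desing_field_def W_def \<phi> Let_def)
  ultimately have ext: "desing_extension \<alpha> \<beta> c k \<kappa> f g"
    by (simp add: desing_extension_def)
  have ab: "a < b" and y: "\<And>t. t \<in> einterval a b \<Longrightarrow> (y has_vector_derivative f (y t)) (at t)"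
    using sol by (auto simp: ode_solution_on_def)
  have x: "x \<in> E" and p_top: "filterlim (\<lambda>t. p (y t)) at_top F" and lim: "((\<lambda>t. T (y t)) \<longlongrightarrow> x) F"
    using dir by (auto simp: tends_to_infinity_in_direction_def)
  \<comment> \<open>Continuity of \<open>S\<close> and \<open>g\<close> is available on the closed
    domain, so limits along the solution are taken within it.\<close>
  have T_closure: "\<forall>\<^sub>F t in F. T (y t) \<in> closure D" and x_closure: "x \<in> closure D"
    using T_in_D x by (auto simp: closure_D intro: always_eventually)
  have "g x = 0"
  proof (rule ccontr)
    assume "g x \<noteq> 0"
    then obtain i where i: "g x $ i \<noteq> 0" by (auto simp: vec_eq_iff)
    \<comment> \<open>Then \<open>C * g x $ i = \<bar>S x\<bar> + 1\<close>, whatever the sign of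
      \<open>g x $ i\<close>. The strict inequality at the limit persists near the end of the time
      interval.\<close>
    define C where "C = (\<bar>S x\<bar> + 1) / g x $ i"
    have "((\<lambda>t. C * g (T (y t)) $ i - \<bar>S (T (y t))\<bar>) \<longlongrightarrow> C * g x $ i - \<bar>S x\<bar>) F"
      by (intro tendsto_intros continuous_on_tendsto_compose[OF S_cont lim x_closure T_closure]
          continuous_on_tendsto_compose[OF g_cont lim x_closure T_closure])
    moreover have "C * g x $ i - \<bar>S x\<bar> > 0"
      using i by (simp add: C_def)
    ultimately have "\<forall>\<^sub>F t in F. C * g (T (y t)) $ i - \<bar>S (T (y t))\<bar> > 0"
      by (rule order_tendstoD)
    then have dom: "\<forall>\<^sub>F t in F. \<bar>\<kappa> (y t) ^ k * S (T (y t))\<bar> \<le> C * (\<kappa> (y t) ^ k * g (T (y t)) $ i)"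
    proof eventually_elim
      case (elim t)
      then have "\<kappa> (y t) ^ k * \<bar>S (T (y t))\<bar> \<le> \<kappa> (y t) ^ k * (C * g (T (y t)) $ i)"
        using \<kappa>_pos[of "y t"] by (intro mult_left_mono) auto
      then show ?case using \<kappa>_pos[of "y t"] by (simp add: abs_mult mult_ac)
    qed
    have "\<not> filterlim (\<lambda>t. ln (\<kappa> (y t))) at_top F"
    \<comment> \<open>The dominating function is \<open>C * T (y t) $ i\<close>, which converges
      with \<open>T (y t)\<close>.\<close>
    proof (rule not_at_top_if_deriv_dominated[OF ab end_filter _ _ dom])
      fix t assume t: "t \<in> einterval a b"
      show "((\<lambda>t. ln (\<kappa> (y t))) has_real_derivative \<kappa> (y t) ^ k * S (T (y t))) (at t)"
        using has_derivative_ln_\<kappa>_solution[OF \<phi> y[OF t]] by (simp add: S_def)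
      show "((\<lambda>t. C * T (y t) $ i) has_real_derivative C * (\<kappa> (y t) ^ k * g (T (y t)) $ i)) (at t)"
        using has_derivative_T_solution[OF \<phi> y[OF t]] by (intro DERIV_cmult) (simp add: g_def S_def)
    next
      show "((\<lambda>t. C * T (y t) $ i) \<longlongrightarrow> C * x $ i) F"
        by (intro tendsto_intros lim)
    qed
    moreover have "filterlim (\<lambda>t. \<kappa> (y t)) at_top F"
      using filterlim_at_top_mono[OF p_top] \<kappa>_gt_p by (simp add: less_imp_le)
    then have "filterlim (\<lambda>t. ln (\<kappa> (y t))) at_top F"
      by (rule filterlim_compose[OF ln_at_top])
    ultimately show False by blast
  qed
  with ext x show ?thesis by blast
qed

end

text \<open>One extension vanishing at \<open>x\<^sub>s\<close> is enough: by
  \<open>desing_extension_unique\<close> all extensions agree on the closed domain, which contains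
  the horizon.\<close>

theorem theorem3p7:
  fixes \<alpha> \<beta> :: "'n::finite \<Rightarrow> nat" and c k :: nat
    and f :: "real^'n \<Rightarrow> real^'n" and \<kappa> :: "real^'n \<Rightarrow> real"
    and y :: "real \<Rightarrow> real^'n" and a b :: ereal and x\<^sub>s :: "real^'n"
  assumes "\<And>i. \<alpha> i \<ge> 1" and "\<And>i. \<beta> i \<ge> 1" and "c \<ge> 1" and "k \<ge> 1"
    and "\<And>i. \<alpha> i * \<beta> i = c"
    and "polynomial_function f"
    and "asymp_quasi_homogeneous \<alpha> k f"
    and "admissible_compactification \<alpha> \<beta> c \<kappa>"
    and "maximal_solution_on f a b y"
    and "tends_to_infinity_in_direction \<alpha> \<beta> c \<kappa> y x\<^sub>s (to_right_end b) \<or>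
         tends_to_infinity_in_direction \<alpha> \<beta> c \<kappa> y x\<^sub>s (to_left_end a)"
  shows "\<exists>g. desing_extension \<alpha> \<beta> c k \<kappa> f g \<and> x\<^sub>s \<in> horizon \<beta> c \<and> g x\<^sub>s = 0"
proof -
  interpret qh_vector_field \<alpha> \<beta> c \<kappa> k f
    by unfold_locales (use assms in auto)
  have "ode_solution_on f a b y"
    using assms(9) by (simp add: maximal_solution_on_def)
  then show ?thesis
    using assms(10) limit_direction_is_equilibrium by blast
qed

end
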